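(* Let $\kappa\ge0$ be a fixed integer. The generating function $$\Psi_\kappa(v):=\sum_{n=\kappa}^{\infty}S(n,\kappa;r)\,v^n$$ of the noncentral $\mathcal{R}(p,q)$-deformed Stirling numbers of the second kind is given by the product $$\Psi_\kappa(v)=v^{\kappa}\prod_{j=0}^{\kappa}\left(1-\epsilon_1^{x-j}\,[r+j]\,v\right)^{-1}$$ for every real $v$ such that $|v|\,\epsilon_1^{x-j}\,\bigl|[r+j]\bigr|<1$ for all $j\in\{0,1,\ldots,\kappa\}$.
   Context: Let $0<q<p\le 1$ be real numbers and let $\mathcal{R}$ be a meromorphic function of two variables. For real $u$ the $\mathcal{R}(p,q)$-deformed number is $[u]:=\mathcal{R}(p^u,q^u)$, and for integer $n\ge1$ the deformed factorial is $[u]_n:=\prod_{i=1}^{n}[u-i+1]$, $[u]_0:=1$. Standing assumption: there are positive real numbers $\epsilon_1=\Phi_1(p,q)$, $\epsilon_2=\Phi_2(p,q)$ such that $[u+v]=\epsilon_1^{v}[u]+\epsilon_2^{u}[v]$ for all real $u,v$. Fix real numbers $x$ and $r$ ($r$ is the noncentrality parameter). The noncentral deformed Stirling numbers of the second kind $S(n,\kappa;r)=S_{\mathcal{R}(p,q)}(n,\kappa;r)$ (which depend also on $x$ through $\epsilon_1^x$) are the coefficients in the polynomial identity $$T^n=\sum_{\kappa=0}^{n}S(n,\kappa;r)\prod_{i=0}^{\kappa-1}\left(T-\epsilon_1^{x-i}[r+i]\right),\qquad n\ge 0;$$ at $T=[x+r]$ this reads $[x+r]^n=\sum_{\kappa=0}^{n}\epsilon_2^{\binom\kappa2+r\kappa}S(n,\kappa;r)[x]_\kappa$.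 *)

theory Defs
  imports "HOL-Analysis.Analysis" "HOL-Computational_Algebra.Polynomial"
begin

text \<open>
  A function of two complex variables is holomorphic on an open set if it is Frechet
  differentiable there with complex-linear derivative.
\<close>

definition holomorphic2_on :: "(complex \<times> complex \<Rightarrow> complex) \<Rightarrow> (complex \<times> complex) set \<Rightarrow> bool"
  where "holomorphic2_on F W \<longleftrightarrow>
    open W \<and> (\<forall>z\<in>W. \<exists>a b. (F has_derivative (\<lambda>(s, t). a * s + b * t)) (at z))"

text \<open>
  Meromorphic means locally a quotient of holomorphic functions whose denominator is not
  identically zero. Functions being total, nothing is prescribed where the denominator vanishes.
\<close>

definition meromorphic2_on :: "(complex \<times> complex \<Rightarrow> complex) \<Rightarrow> (complex \<times> complex) set \<Rightarrow> bool"
  where "meromorphic2_on F D \<longleftrightarrow>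
    open D \<and> (\<forall>z\<in>D. \<exists>W g h. z \<in> W \<and> W \<subseteq> D \<and> connected W \<and>
      holomorphic2_on g W \<and> holomorphic2_on h W \<and> (\<exists>w\<in>W. h w \<noteq> 0) \<and>
      (\<forall>w\<in>W. h w \<noteq> 0 \<longrightarrow> F w = g w / h w))"

definition deformed_number ::
    "(complex \<times> complex \<Rightarrow> complex) \<Rightarrow> real \<Rightarrow> real \<Rightarrow> real \<Rightarrow> complex"
  where "deformed_number R p q u = R (complex_of_real (p powr u), complex_of_real (q powr u))"

definition newton_poly :: "(nat \<Rightarrow> complex) \<Rightarrow> nat \<Rightarrow> complex poly"
  where "newton_poly a k = (\<Prod>i<k. [:- a i, 1:])"

definition nc_node ::
    "(complex \<times> complex \<Rightarrow> complex) \<Rightarrow> real \<Rightarrow> real \<Rightarrow> real \<Rightarrow> real \<Rightarrow> real \<Rightarrow> nat \<Rightarrow> complex"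
  where "nc_node R p q \<epsilon>1 x r i =
    complex_of_real (\<epsilon>1 powr (x - real i)) * deformed_number R p q (r + real i)"

text \<open>
  The coefficients are normalised to be 0 above the degree, which makes them unique
  (lemma \<open>newton_coeffs_ex1\<close>).
\<close>

definition nc_stirling2 ::
    "(complex \<times> complex \<Rightarrow> complex) \<Rightarrow> real \<Rightarrow> real \<Rightarrow> real \<Rightarrow> real \<Rightarrow> real \<Rightarrow> nat \<Rightarrow> nat \<Rightarrow> complex"
  where "nc_stirling2 R p q \<epsilon>1 x r n =
    (THE c. (\<forall>k>n. c k = 0) \<and>
       monom 1 n = (\<Sum>k\<le>n. smult (c k) (newton_poly (nc_node R p q \<epsilon>1 x r) k)))"

text \<open>The series over \<open>n \<ge> k\<close>, reindexed by \<open>n = m + k\<close>.\<close>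

definition nc_stirling2_term ::
    "(complex \<times> complex \<Rightarrow> complex) \<Rightarrow> real \<Rightarrow> real \<Rightarrow> real \<Rightarrow> real \<Rightarrow> real \<Rightarrow> nat \<Rightarrow> real \<Rightarrow> nat \<Rightarrow> complex"
  where "nc_stirling2_term R p q \<epsilon>1 x r k v m =
    nc_stirling2 R p q \<epsilon>1 x r (m + k) k * complex_of_real v ^ (m + k)"

definition nc_stirling2_gf ::
    "(complex \<times> complex \<Rightarrow> complex) \<Rightarrow> real \<Rightarrow> real \<Rightarrow> real \<Rightarrow> real \<Rightarrow> real \<Rightarrow> nat \<Rightarrow> real \<Rightarrow> complex"
  where "nc_stirling2_gf R p q \<epsilon>1 x r k v = (\<Sum>m. nc_stirling2_term R p q \<epsilon>1 x r k v m)"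

lemma newton_poly_monic:
  "degree (newton_poly a k) = k" "coeff (newton_poly a k) k = 1"
proof -
  have "degree (newton_poly a k) = k \<and> coeff (newton_poly a k) k = 1"
  proof (induction k)
    case 0
    show ?case by (simp add: newton_poly_def)
  next
    case (Suc k)
    have nz: "newton_poly a k \<noteq> 0" using Suc by auto
    have eq: "newton_poly a (Suc k) = newton_poly a k * [:- a k, 1:]"
      by (simp add: newton_poly_def)
    have "degree (newton_poly a (Suc k)) = Suc k"
      unfolding eq by (subst degree_mult_eq) (use nz Suc in auto)
    moreover have "lead_coeff (newton_poly a (Suc k)) = 1"
      unfolding eq lead_coeff_mult using Suc by simp
    ultimately show ?case by simp
  qed
  then show "degree (newton_poly a k) = k" "coeff (newton_poly a k) k = 1" by auto
qed

lemma newton_coeffs_exist: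
  "degree P \<le> n \<Longrightarrow> \<exists>c. (\<forall>k>n. c k = 0) \<and> P = (\<Sum>k\<le>n. smult (c k) (newton_poly a k))"
proof (induction n arbitrary: P)
  case 0
  then obtain b where "P = [:b:]" using degree_eq_zeroE by blast
  then show ?case
    by (intro exI[of _ "\<lambda>k. if k = 0 then b else 0"]) (simp add: newton_poly_def)
next
  case (Suc n)
  define b where "b = coeff P (Suc n)"
  define Q where "Q = P - smult b (newton_poly a (Suc n))"
  have "coeff Q i = 0" if "i > n" for i
  proof (cases "i = Suc n")
    case True
    then show ?thesis by (simp add: Q_def b_def newton_poly_monic)
  next
    case False
    then have "i > Suc n" using that by simp
    then show ?thesis
      using Suc.prems by (simp add: Q_def coeff_eq_0 newton_poly_monic)
  qed
  then have "degree Q \<le> n" by (simp add: degree_le)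
  then obtain c where c: "\<forall>k>n. c k = 0" "Q = (\<Sum>k\<le>n. smult (c k) (newton_poly a k))"
    using Suc.IH by blast
  have "(\<Sum>k\<le>n. smult ((c(Suc n := b)) k) (newton_poly a k)) = Q"
    unfolding c(2) by (rule sum.cong) auto
  then show ?case
    using c(1) by (intro exI[of _ "c(Suc n := b)"]) (auto simp: Q_def)
qed

lemma newton_coeffs_zero:
  "(\<Sum>k\<le>n. smult (d k) (newton_poly a k)) = 0 \<Longrightarrow> k \<le> n \<Longrightarrow> d k = 0"
proof (induction n)
  case 0
  then show ?case by (simp add: newton_poly_def)
next
  case (Suc n)
  have "coeff (\<Sum>k\<le>Suc n. smult (d k) (newton_poly a k)) (Suc n) = d (Suc n)"
    by (simp add: coeff_sum newton_poly_monic coeff_eq_0)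
  then have "d (Suc n) = 0" using Suc.prems(1) by (metis coeff_0)
  then show ?case using Suc by (cases "k = Suc n") auto
qed

lemma newton_coeffs_ex1:
  "\<exists>!c. (\<forall>k>n. c k = 0) \<and> monom 1 n = (\<Sum>k\<le>n. smult (c k) (newton_poly a k))"
proof (rule ex_ex1I)
  show "\<exists>c. (\<forall>k>n. c k = 0) \<and> monom 1 n = (\<Sum>k\<le>n. smult (c k) (newton_poly a k))"
    by (rule newton_coeffs_exist) (simp add: degree_monom_le)
next
  fix c d
  assume c: "(\<forall>k>n. c k = 0) \<and> monom 1 n = (\<Sum>k\<le>n. smult (c k) (newton_poly a k))"
    and d: "(\<forall>k>n. d k = 0) \<and> monom 1 n = (\<Sum>k\<le>n. smult (d k) (newton_poly a k))"
  have "(\<Sum>k\<le>n. smult (c k - d k) (newton_poly a k)) = 0"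
    using c d by (simp add: smult_diff_left sum_subtractf)
  then have "c k - d k = 0" if "k \<le> n" for k
    using newton_coeffs_zero[of "\<lambda>k. c k - d k"] that by blast
  then have "c k = d k" for k using c d by (cases "k \<le> n") auto
  then show "c = d" by blast
qed

end

theory Submission imports Defs begin

text \<open>
  The coefficient \<open>S(m + k, k; r)\<close> is the complete homogeneous symmetric polynomial of
  degree \<open>m\<close> in the interpolation nodes \<open>a\<^sub>0, \<dots>, a\<^sub>k\<close>: multiplying a Newton
  expansion by \<open>T = (T - a\<^sub>k) + a\<^sub>k\<close> yields the triangular recurrence that characterises
  these polynomials. Adjoining a node to a complete homogeneous polynomial is a Cauchy product with
  a geometric series, so the generating function is a product of geometric series.
\<close>

text \<open>Index \<open>k\<close> stands for the \<open>k + 1\<close> variables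
  \<open>a 0, ..., a k\<close>. The recursion runs over the nodes and leaves the degree free, so
  that adding a node is a convolution with its powers.\<close>

primrec complete_hom :: "(nat \<Rightarrow> 'a::comm_semiring_1) \<Rightarrow> nat \<Rightarrow> nat \<Rightarrow> 'a" where
  "complete_hom a 0 = (\<lambda>m. a 0 ^ m)"
| "complete_hom a (Suc k) = (\<lambda>m. \<Sum>i\<le>m. complete_hom a k i * a (Suc k) ^ (m - i))"

lemma complete_hom_degree_0 [simp]: "complete_hom a k 0 = 1"
  by (induction k) auto

text \<open>In the convolution, every summand except the last contains the new node as a factor; the
  last one is free of it.\<close>

lemma complete_hom_Suc_Suc:
  "complete_hom a (Suc k) (Suc m) =
     a (Suc k) * complete_hom a (Suc k) m + complete_hom a k (Suc m)"
proof -
  have "(\<Sum>i\<le>m. complete_hom a k i * a (Suc k) ^ (Suc m - i)) =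
      a (Suc k) * (\<Sum>i\<le>m. complete_hom a k i * a (Suc k) ^ (m - i))"
    unfolding sum_distrib_left
    by (intro sum.cong) (auto simp: Suc_diff_le ac_simps)
  then show ?thesis by simp
qed

lemma newton_poly_Suc_eq:
  "[:0, 1:] * newton_poly a k = newton_poly a (Suc k) + smult (a k) (newton_poly a k)"
proof -
  have "[:0, 1:] = [:- a k, 1:] + [:a k:]" by simp
  then show ?thesis by (simp add: newton_poly_def algebra_simps)
qed

lemma monom_newton_expansion:
  "monom 1 n = (\<Sum>k\<le>n. smult (complete_hom a k (n - k)) (newton_poly a k))"
proof (induction n)
  case 0
  show ?case by (simp add: newton_poly_def)
next
  case (Suc n)
  let ?h = "complete_hom a" and ?N = "newton_poly a"
  \<comment> \<open>The bound \<open>k < n\<close> makes the degree \<open>n - k\<close> a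
    successor, as the recurrence requires.\<close>
  have rec: "?h (Suc k) (n - k) = ?h k (n - k) + a (Suc k) * ?h (Suc k) (n - Suc k)"
    if "k < n" for k
    using that complete_hom_Suc_Suc[of a k "n - Suc k"] by (simp add: Suc_diff_Suc)
  have "monom 1 (Suc n) = [:0, 1:] * monom (1::complex) n"
    by (simp add: monom_Suc)
  also have "\<dots> = (\<Sum>k\<le>n. smult (?h k (n - k)) ([:0, 1:] * ?N k))"
    unfolding Suc.IH by (simp add: sum_distrib_left)
  also have "\<dots> = (\<Sum>k\<le>n. smult (?h k (n - k)) (?N (Suc k))) +
      (\<Sum>k\<le>n. smult (a k * ?h k (n - k)) (?N k))"
    unfolding newton_poly_Suc_eq
    by (simp add: smult_add_right sum.distrib mult.commute[of "a _"])
  \<comment> \<open>The top term, out of reach of \<open>rec\<close>, is split off; its coefficient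
    has degree 0 and equals 1.\<close>
  also have "(\<Sum>k\<le>n. smult (?h k (n - k)) (?N (Suc k))) =
      (\<Sum>k<n. smult (?h k (n - k)) (?N (Suc k))) + ?N (Suc n)"
    by (simp flip: lessThan_Suc_atMost)
  \<comment> \<open>Shifting the index aligns both sums on \<open>?N (Suc k)\<close>, ready for
    \<open>rec\<close>.\<close>
  also have "(\<Sum>k\<le>n. smult (a k * ?h k (n - k)) (?N k)) =
      smult (a 0 ^ Suc n) (?N 0) +
      (\<Sum>k<n. smult (a (Suc k) * ?h (Suc k) (n - Suc k)) (?N (Suc k)))"
    by (subst sum.atMost_shift) simp
  also have "(\<Sum>k<n. smult (?h k (n - k)) (?N (Suc k))) + ?N (Suc n) +
      (smult (a 0 ^ Suc n) (?N 0) +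
        (\<Sum>k<n. smult (a (Suc k) * ?h (Suc k) (n - Suc k)) (?N (Suc k)))) =
      smult (a 0 ^ Suc n) (?N 0) +
      ((\<Sum>k<n. smult (?h (Suc k) (n - k)) (?N (Suc k))) + ?N (Suc n))"
    by (simp add: rec smult_add_left sum.distrib del: complete_hom.simps)
  also have "(\<Sum>k<n. smult (?h (Suc k) (n - k)) (?N (Suc k))) + ?N (Suc n) =
      (\<Sum>k<Suc n. smult (?h (Suc k) (n - k)) (?N (Suc k)))"
    by (simp del: complete_hom.simps)
  also have "smult (a 0 ^ Suc n) (?N 0) + \<dots> =
      (\<Sum>k\<le>Suc n. smult (?h k (Suc n - k)) (?N k))"
    by (subst sum.atMost_shift) simp
  finally show ?case .
qed

lemma nc_stirling2_eq_complete_hom: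
  "nc_stirling2 R p q \<epsilon>1 x r (m + k) k = complete_hom (nc_node R p q \<epsilon>1 x r) k m"
proof -
  let ?a = "nc_node R p q \<epsilon>1 x r"
  \<comment> \<open>The extension by 0 meets the normalisation under which Newton coefficients are
    unique.\<close>
  have "nc_stirling2 R p q \<epsilon>1 x r (m + k) =
      (\<lambda>j. if j \<le> m + k then complete_hom ?a j (m + k - j) else 0)"
    unfolding nc_stirling2_def
    by (rule the1_equality[OF newton_coeffs_ex1])
      (simp add: monom_newton_expansion[where a = ?a])
  then show ?thesis by simp
qed

text \<open>Comparison with the Cauchy product of the two series of norms. This carries absolute
  convergence through the induction on the nodes.\<close>

lemma summable_norm_Cauchy_product:
  fixes f g :: "nat \<Rightarrow> 'a::{real_normed_algebra,banach}"
  assumes "summable (\<lambda>n. norm (f n))" and "summable (\<lambda>n. norm (g n))"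
  shows "summable (\<lambda>n. norm (\<Sum>i\<le>n. f i * g (n - i)))"
proof (rule summable_comparison_test')
  show "summable (\<lambda>n. \<Sum>i\<le>n. norm (f i) * norm (g (n - i)))"
    using assms by (intro summable_Cauchy_product) simp_all
  show "norm (norm (\<Sum>i\<le>n. f i * g (n - i))) \<le> (\<Sum>i\<le>n. norm (f i) * norm (g (n - i)))"
    if "0 \<le> n" for n
    by (simp add: sum_norm_le norm_mult_ineq)
qed

text \<open>Absolute summability is part of the claim because the Cauchy product theorem in the
  induction step asks for it.\<close>

lemma complete_hom_generating_function:
  fixes a :: "nat \<Rightarrow> 'a::{real_normed_field,banach}"
  assumes "\<And>j. j \<le> k \<Longrightarrow> norm (a j * v) < 1"
  shows "summable (\<lambda>m. norm (complete_hom a k m * v ^ m)) \<and>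
    (\<lambda>m. complete_hom a k m * v ^ m) sums (\<Prod>j=0..k. inverse (1 - a j * v))"
  using assms
proof (induction k)
  case 0
  then show ?case
    using geometric_sums[of "a 0 * v"] summable_geometric[of "norm (a 0 * v)"]
    by (simp add: power_mult_distrib[symmetric] norm_power divide_inverse)
next
  case (Suc k)
  let ?f = "\<lambda>m. complete_hom a k m * v ^ m" and ?g = "\<lambda>m. (a (Suc k) * v) ^ m"
  \<comment> \<open>Distributing \<open>v ^ m\<close> as \<open>v ^ i * v ^ (m - i)\<close> turns
    the defining convolution into a Cauchy product.\<close>
  have eq: "complete_hom a (Suc k) m * v ^ m = (\<Sum>i\<le>m. ?f i * ?g (m - i))" for m
  proof -
    have "v ^ m = v ^ i * v ^ (m - i)" if "i \<le> m" for i
      using that by (simp flip: power_add)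
    then show ?thesis
      unfolding complete_hom.simps sum_distrib_right
      by (intro sum.cong) (simp_all add: power_mult_distrib mult_ac)
  qed
  have f: "summable (\<lambda>m. norm (?f m))" "?f sums (\<Prod>j=0..k. inverse (1 - a j * v))"
    using Suc by simp_all
  have lt: "norm (a (Suc k) * v) < 1" using Suc.prems by simp
  have g: "summable (\<lambda>m. norm (?g m))"
    using summable_geometric[of "norm (a (Suc k) * v)"] lt by (simp add: norm_power)
  have "(\<Sum>m. ?g m) = inverse (1 - a (Suc k) * v)"
    using suminf_geometric[OF lt] by (simp add: divide_inverse)
  then show ?case
    unfolding eq
    using summable_norm_Cauchy_product[OF f(1) g] Cauchy_product_sums[OF f(1) g] sums_unique[OF f(2)]
    by simp
qed

theorem theorem3p36:
  fixes p q \<epsilon>1 \<epsilon>2 x r v :: real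
    and R :: "complex \<times> complex \<Rightarrow> complex"
    and D :: "(complex \<times> complex) set"
    and \<kappa> :: nat
  assumes "0 < q" and "q < p" and "p \<le> 1"
    and "connected D" and "meromorphic2_on R D"
    and "\<And>u. (complex_of_real (p powr u), complex_of_real (q powr u)) \<in> D"
    and "\<epsilon>1 > 0" and "\<epsilon>2 > 0"
    and "\<And>s t. deformed_number R p q (s + t) =
           complex_of_real (\<epsilon>1 powr t) * deformed_number R p q s
           + complex_of_real (\<epsilon>2 powr s) * deformed_number R p q t"
    and "\<And>j. j \<in> {0..\<kappa>} \<Longrightarrow>
           \<bar>v\<bar> * \<epsilon>1 powr (x - real j) * cmod (deformed_number R p q (r + real j)) < 1"
  shows "summable (nc_stirling2_term R p q \<epsilon>1 x r \<kappa> v) \<and>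
         nc_stirling2_gf R p q \<epsilon>1 x r \<kappa> v =
           complex_of_real v ^ \<kappa> *
           (\<Prod>j=0..\<kappa>. inverse (1 - complex_of_real (\<epsilon>1 powr (x - real j))
                                   * deformed_number R p q (r + real j) * complex_of_real v))"
proof -
  let ?a = "nc_node R p q \<epsilon>1 x r" and ?v = "complex_of_real v"
  have "norm (?a j * ?v) < 1" if "j \<le> \<kappa>" for j
    using assms(10)[of j] that by (simp add: nc_node_def norm_mult mult_ac)
  then have "(\<lambda>m. complete_hom ?a \<kappa> m * ?v ^ m) sums (\<Prod>j=0..\<kappa>. inverse (1 - ?a j * ?v))"
    by (intro conjunct2[OF complete_hom_generating_function]) simp
  \<comment> \<open>The reindexing by \<open>m + \<kappa>\<close> in the series contributes the
    prefactor \<open>?v ^ \<kappa>\<close>.\<close>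
  then have "(\<lambda>m. ?v ^ \<kappa> * (complete_hom ?a \<kappa> m * ?v ^ m)) sums
      (?v ^ \<kappa> * (\<Prod>j=0..\<kappa>. inverse (1 - ?a j * ?v)))"
    by (rule sums_mult)
  moreover have "nc_stirling2_term R p q \<epsilon>1 x r \<kappa> v =
      (\<lambda>m. ?v ^ \<kappa> * (complete_hom ?a \<kappa> m * ?v ^ m))"
    by (simp add: fun_eq_iff nc_stirling2_term_def nc_stirling2_eq_complete_hom power_add mult_ac)
  ultimately have "nc_stirling2_term R p q \<epsilon>1 x r \<kappa> v sums
      (?v ^ \<kappa> * (\<Prod>j=0..\<kappa>. inverse (1 - ?a j * ?v)))"
    by simp
  then show ?thesis
    unfolding nc_stirling2_gf_def nc_node_def
    by (simp add: sums_iff)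
qed

end
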